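(* Let $n$ be a positive integer, let $\vec{x}=(x_1,x_2,\dots,x_n)$ be a vector of positive real numbers, and let $D(\vec{x})$ be the $n\times n$ cell matrix constructed from $\vec{x}$. If $\pi\in S_n$, then $D(\vec{x})$ and $D(\pi(\vec{x}))$ have the same spectrum.
   Context: For a vector $\vec{x}=(x_1,\dots,x_n)$ of positive real numbers, the cell matrix $D(\vec{x})\in\mathbb{R}^{n\times n}$ associated with $\vec{x}$ is defined by $(D(\vec{x}))_{ij}=0$ if $i=j$ and $(D(\vec{x}))_{ij}=x_i+x_j$ if $i\neq j$. $S_n$ is the group of permutations of $\{1,\dots,n\}$, and for $\pi\in S_n$, $\pi(\vec{x})$ denotes the vector $(x_{\pi(1)},x_{\pi(2)},\dots,x_{\pi(n)})$. The spectrum of a square matrix is the collection of all its eigenvalues, counted with algebraic multiplicity. *)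

theory Defs
  imports
    "Jordan_Normal_Form.Char_Poly"
    "HOL-Combinatorics.Permutations"
    "HOL-Computational_Algebra.Polynomial"
    Complex_Main
begin

text \<open>Vectors and matrices are indexed from \<open>0\<close>, so the index set \<open>{1, \<dots>, n}\<close> becomes \<open>{0..<n}\<close>.\<close>

definition cell_matrix :: "real vec \<Rightarrow> real mat" where
  "cell_matrix x = mat (dim_vec x) (dim_vec x) (\<lambda>(i, j). if i = j then 0 else x $ i + x $ j)"

definition permute_vec :: "(nat \<Rightarrow> nat) \<Rightarrow> 'a vec \<Rightarrow> 'a vec" where
  "permute_vec \<pi> x = vec (dim_vec x) (\<lambda>i. x $ \<pi> i)"

text \<open>The eigenvalues of a real matrix are taken in \<open>\<complex>\<close>; \<open>proots\<close> records each root of the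
  characteristic polynomial as often as its multiplicity, that is, its algebraic multiplicity
  as an eigenvalue.\<close>

definition spectrum_mset :: "real mat \<Rightarrow> complex multiset" where
  "spectrum_mset A = proots (char_poly (map_mat complex_of_real A))"

lemma set_spectrum_mset:
  assumes "A \<in> carrier_mat n n"
  shows "set_mset (spectrum_mset A) = Collect (eigenvalue (map_mat complex_of_real A))"
proof -
  have A: "map_mat complex_of_real A \<in> carrier_mat n n"
    using assms by simp
  then have "char_poly (map_mat complex_of_real A) \<noteq> 0"
    using degree_monic_char_poly[OF A] by auto
  then show ?thesis
    by (auto simp: spectrum_mset_def eigenvalue_root_char_poly[OF A])
qed

lemma count_spectrum_mset:
  assumes "A \<in> carrier_mat n n"
  shows "count (spectrum_mset A) k = order k (char_poly (map_mat complex_of_real A))"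
proof -
  have A: "map_mat complex_of_real A \<in> carrier_mat n n"
    using assms by simp
  then have "char_poly (map_mat complex_of_real A) \<noteq> 0"
    using degree_monic_char_poly[OF A] by auto
  then show ?thesis
    by (simp add: spectrum_mset_def)
qed

end

theory Submission
  imports Defs
begin

text \<open>Permuting the parameters only relabels the indices: the (i, j) entry of the new cell
  matrix is the (\<pi> i, \<pi> j) entry of the old one, so the two are similar via a permutation
  matrix. Similarity is not invoked; instead, a simultaneous row and column permutation preserves
  determinants because the sign enters twice (\<open>det_permute_rows_cols\<close>), and applying
  this to XI - A gives equal characteristic polynomials (\<open>char_poly_permute\<close>), hence
  equal roots with multiplicity.\<close>

lemma det_permute_rows_cols:
  fixes A :: "'a::comm_ring_1 mat"
  assumes A: "A \<in> carrier_mat n n" and p: "p permutes {0..<n}"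
  shows "det (mat n n (\<lambda>(i, j). A $$ (p i, p j))) = det A"
proof -
  \<comment> \<open>Columns are permuted as rows of the transpose: \<open>B\<close> has the rows of
    \<open>A\<close> permuted, and \<open>C\<close> is the transpose of the target matrix.\<close>
  define B where "B = mat n n (\<lambda>(i, j). A $$ (p i, j))"
  define C where "C = mat n n (\<lambda>(i, j). transpose_mat B $$ (p i, j))"
  have less: "p i < n" if "i < n" for i
    using permutes_in_image[OF p, of i] that by simp
  have "mat n n (\<lambda>(i, j). A $$ (p i, p j)) = transpose_mat C"
    by (rule eq_matI) (auto simp: B_def C_def less)
  also have "det \<dots> = det C"
    by (rule det_transpose[of _ n]) (simp add: C_def)
  also have "\<dots> = signof p * det (transpose_mat B)"
    unfolding C_def by (rule det_permute_rows[OF _ p]) (simp add: B_def)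
  also have "det (transpose_mat B) = det B"
    by (rule det_transpose[of _ n]) (simp add: B_def)
  also have "det B = signof p * det A"
    unfolding B_def by (rule det_permute_rows[OF A p])
  \<comment> \<open>A sign is 1 or -1, so it squares to 1.\<close>
  also have "signof p * (signof p * det A) = det A"
    by (simp add: sign_def)
  finally show ?thesis .
qed

text \<open>Relabelling commutes with forming XI - A, since an injective \<open>p\<close> sends
  diagonal positions to diagonal ones and off-diagonal to off-diagonal. The determinant lemma is
  then used over the polynomial ring.\<close>

lemma char_poly_permute:
  fixes A :: "'a::comm_ring_1 mat"
  assumes A: "A \<in> carrier_mat n n" and p: "p permutes {0..<n}"
  shows "char_poly (mat n n (\<lambda>(i, j). A $$ (p i, p j))) = char_poly A"
proof -
  have less: "p i < n" if "i < n" for i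
    using permutes_in_image[OF p, of i] that by simp
  have eq: "p i = p j \<longleftrightarrow> i = j" for i j
    using permutes_inj[OF p] by (auto dest: injD)
  have "char_poly_matrix (mat n n (\<lambda>(i, j). A $$ (p i, p j))) =
    mat n n (\<lambda>(i, j). char_poly_matrix A $$ (p i, p j))"
    using A by (intro eq_matI) (auto simp: char_poly_matrix_def less eq)
  then show ?thesis
    using A by (simp add: char_poly_def det_permute_rows_cols[OF _ p])
qed

theorem theorem4p2:
  fixes n :: nat and x :: "real vec" and \<pi> :: "nat \<Rightarrow> nat"
  assumes "n \<ge> 1"
    and "x \<in> carrier_vec n"
    and "\<And>i. i < n \<Longrightarrow> x $ i > 0"
    and "\<pi> permutes {0..<n}"
  shows "spectrum_mset (cell_matrix x) = spectrum_mset (cell_matrix (permute_vec \<pi> x))"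
proof -
  let ?A = "map_mat complex_of_real (cell_matrix x)"
  have A: "?A \<in> carrier_mat n n"
    using assms(2) by (simp add: cell_matrix_def)
  have less: "\<pi> i < n" if "i < n" for i
    using permutes_in_image[OF assms(4), of i] that by simp
  have eq: "\<pi> i = \<pi> j \<longleftrightarrow> i = j" for i j
    using permutes_inj[OF assms(4)] by (auto dest: injD)
  \<comment> \<open>Injectivity of \<pi> makes the zero diagonals match; off the diagonal both
    entries are \<open>x $ \<pi> i + x $ \<pi> j\<close>.\<close>
  have "map_mat complex_of_real (cell_matrix (permute_vec \<pi> x)) =
    mat n n (\<lambda>(i, j). ?A $$ (\<pi> i, \<pi> j))"
    using assms(2) by (intro eq_matI) (auto simp: cell_matrix_def permute_vec_def less eq)
  then show ?thesis
    by (simp add: spectrum_mset_def char_poly_permute[OF A assms(4)])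
qed

end
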